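(* As $k\to\infty$ (over positive integers $k$), $$V^A(k,k) \sim 2V(k,k), \qquad T^A(k,k) \sim T(k,k).$$
   Context: Mabinogion urn model (M-process): an urn contains white and black balls. At each time $1,2,3,\dots$ one ball is drawn uniformly at random from the urn, independently of previous selections, its color is observed and it is returned. If the drawn ball is white, one black ball is replaced by a white one; if it is black, one white ball is replaced by a black one. So from a state with $w>0$ white and $b>0$ black balls, a draw leads to $(w+1,b-1)$ with probability $\frac{w}{w+b}$ and to $(w-1,b+1)$ with probability $\frac{b}{w+b}$. The process stops (is absorbed) when all remaining balls are of the same color. For the M-process started with $w$ white and $b$ black balls, $V(w,b)$ is the expected number of black balls at absorption and $T(w,b)$ is the expected time to absorption (number of draws). Policy A: at time $0$ and immediately after each draw, if the number of white balls is greater than or equal to the number of black balls, immediately reduce (by permanently removing white balls) the number of white balls to one less than the number of black balls; otherwise do nothing. Removals take no time. $V^A(w,b)$ and $T^A(w,b)$ denote the expected final number of black balls and the expected time to absorption when Policy A is applied throughout (including at time $0$), starting with $w$ white and $b$ black balls. The notation $f(k)\sim g(k)$ means $\lim_{k\to\infty} f(k)/g(k)=1$. *)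

theory Defs
  imports "HOL-Probability.Probability"
begin

text \<open>A state \<open>(w, b)\<close> is an urn with \<open>w\<close> white and \<open>b\<close> black balls.\<close>

type_synonym urn = "nat \<times> nat"

definition absorbed :: "urn \<Rightarrow> bool" where
  "absorbed s \<longleftrightarrow> fst s = 0 \<or> snd s = 0"

text \<open>
  Number the balls \<open>0, \<dots>, w + b - 1\<close>, the white ones first. For \<open>u\<close> uniform on \<open>[0, 1)\<close>, the number
  \<open>\<lfloor>u * (w + b)\<rfloor>\<close> is a uniformly drawn ball, and it is white iff it is less than \<open>w\<close>, that is, iff
  \<open>u * (w + b) < w\<close>.
\<close>

definition draw :: "real \<Rightarrow> urn \<Rightarrow> urn" where
  "draw u = (\<lambda>(w, b).
     if absorbed (w, b) then (w, b)
     else if u * real (w + b) < real w then (w + 1, b - 1)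
     else (w - 1, b + 1))"

definition draws :: "real stream measure" where
  "draws = stream_space (uniform_measure lborel {0..<1})"

text \<open>
  The policy \<open>p\<close> maps the contents of the urn to what is left after its (instantaneous) removals; it
  acts at time \<open>0\<close> and after each draw. Time \<open>n\<close> is reached after \<open>n\<close> draws and the removal that
  follows the last of them.
\<close>

primrec urn_at :: "(urn \<Rightarrow> urn) \<Rightarrow> urn \<Rightarrow> real stream \<Rightarrow> nat \<Rightarrow> urn" where
  "urn_at p s \<omega> 0 = p s"
| "urn_at p s \<omega> (Suc n) = p (draw (\<omega> !! n) (urn_at p s \<omega> n))"

definition absorption_time :: "(urn \<Rightarrow> urn) \<Rightarrow> urn \<Rightarrow> real stream \<Rightarrow> enat" where
  "absorption_time p s \<omega> = Inf {enat n | n. absorbed (urn_at p s \<omega> n)}"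

text \<open>
  The value \<open>0\<close> on paths that are never absorbed is a dummy: for the two policies
  considered below, \<open>id\<close> (no removals) and \<open>policy_A\<close>, these paths form a null set.
\<close>

definition final_black :: "(urn \<Rightarrow> urn) \<Rightarrow> urn \<Rightarrow> real stream \<Rightarrow> nat" where
  "final_black p s \<omega> =
     (case absorption_time p s \<omega> of enat n \<Rightarrow> snd (urn_at p s \<omega> n) | \<infinity> \<Rightarrow> 0)"

definition expected_black :: "(urn \<Rightarrow> urn) \<Rightarrow> urn \<Rightarrow> real" where
  "expected_black p s = (\<integral>\<omega>. real (final_black p s \<omega>) \<partial>draws)"

definition expected_time :: "(urn \<Rightarrow> urn) \<Rightarrow> urn \<Rightarrow> real" where
  "expected_time p s = enn2real (\<integral>\<^sup>+\<omega>. ennreal_of_enat (absorption_time p s \<omega>) \<partial>draws)"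

text \<open>
  With no black balls the urn is already absorbed, and there is no number of white balls that is one
  less than the number of black ones; the policy does nothing.
\<close>

definition policy_A :: "urn \<Rightarrow> urn" where
  "policy_A = (\<lambda>(w, b). if 0 < b \<and> b \<le> w then (b - 1, b) else (w, b))"

definition V :: "nat \<Rightarrow> nat \<Rightarrow> real" where
  "V w b = expected_black id (w, b)"

definition T :: "nat \<Rightarrow> nat \<Rightarrow> real" where
  "T w b = expected_time id (w, b)"

definition V_A :: "nat \<Rightarrow> nat \<Rightarrow> real" where
  "V_A w b = expected_black policy_A (w, b)"

definition T_A :: "nat \<Rightarrow> nat \<Rightarrow> real" where
  "T_A w b = expected_time policy_A (w, b)"

lemma prob_space_draws: "prob_space draws"
  unfolding draws_def
  by (intro prob_space.prob_space_stream_space prob_space_uniform_measure) auto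

lemma prob_white:
  assumes "0 < w + b"
  shows "measure (uniform_measure lborel {0..<1}) {u. u * real (w + b) < real w} = w / (w + b)"
proof -
  have le: "w / (w + b) \<le> (1::real)"
    by (rule divide_le_eq_1_pos[THEN iffD2]) (use assms in auto)
  have less: "u * real (w + b) < real w \<longleftrightarrow> u < w / (w + b)" for u
    by (rule pos_less_divide_eq[symmetric]) (use assms in linarith)
  have "{0..<1} \<inter> {u. u * real (w + b) < real w} = {0..<w / (w + b)}"
    unfolding less using le by (auto simp del: of_nat_add)
  moreover have "{u::real. u * real (w + b) < real w} \<in> sets lborel"
    by simp
  ultimately show ?thesis
    by (subst measure_uniform_measure) auto
qed

lemma measurable_urn_at [measurable]:
  "(\<lambda>\<omega>. urn_at p s \<omega> n) \<in> draws \<rightarrow>\<^sub>M count_space UNIV"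
proof (induction n)
  case 0
  then show ?case by simp
next
  case (Suc n)
  have [measurable_cong]: "sets draws = sets (stream_space borel)"
    unfolding draws_def by (intro sets_stream_space_cong) simp
  note Suc [measurable]
  have [measurable]: "(\<lambda>u. p (draw u t)) \<in> borel \<rightarrow>\<^sub>M count_space UNIV" for t
    unfolding draw_def by (cases t) simp
  show ?case
    unfolding urn_at.simps
    by (rule measurable_compose_countable[where f = "\<lambda>t \<omega>. p (draw (\<omega> !! n) t)" and g = "\<lambda>\<omega>. urn_at p s \<omega> n"])
       measurable
qed

lemma measurable_absorption_time [measurable]:
  "absorption_time p s \<in> draws \<rightarrow>\<^sub>M count_space UNIV"
proof -
  have "absorption_time p s = (\<lambda>\<omega>. INF n. if absorbed (urn_at p s \<omega> n) then enat n else \<infinity>)"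
    unfolding absorption_time_def
    by (intro ext antisym Inf_greatest INF_greatest) (auto intro: Inf_lower INF_lower2)
  also have "\<dots> \<in> draws \<rightarrow>\<^sub>M count_space UNIV" by measurable
  finally show ?thesis .
qed

lemma measurable_final_black [measurable]:
  "final_black p s \<in> draws \<rightarrow>\<^sub>M count_space UNIV"
proof -
  have "(\<lambda>\<omega>. case t of enat n \<Rightarrow> snd (urn_at p s \<omega> n) | \<infinity> \<Rightarrow> 0) \<in> draws \<rightarrow>\<^sub>M count_space UNIV"
    for t
  proof (cases t)
    case (enat n)
    have "(\<lambda>\<omega>. snd (urn_at p s \<omega> n)) \<in> draws \<rightarrow>\<^sub>M count_space UNIV"
      by (rule measurable_compose[OF measurable_urn_at]) simp
    with enat show ?thesis by simp
  qed simp
  then show ?thesis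
    unfolding final_black_def[abs_def]
    by (rule measurable_compose_countable[where g = "absorption_time p s"]) measurable
qed

end

theory Submission
  imports Defs "HOL-Library.Discrete_Functions" "HOL-Real_Asymp.Real_Asymp"
begin

text \<open>
  As long as nothing is removed, the urn is a birth-death chain, so the first-step equations of an
  expectation are first-order recursions for its differences between neighbouring states. Without
  removals they give \<open>V k k = k\<close> by symmetry. For the times, the differences \<open>e j\<close> are nearly \<open>k / j\<close>
  for \<open>j\<close> above \<open>sqrt k\<close> and negligible in sum below, hence \<open>T k k = k / 2 * ln k + O(k)\<close>.

  Under Policy A consider the states with \<open>m - 1\<close> white and \<open>m\<close> black balls. The chain from there
  is either absorbed at \<open>2 * m - 1\<close> black balls, with probability \<open>p\<close> of order at least \<open>1 / sqrt m\<close>,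
  or moves on to the same kind of state for \<open>m - 1\<close>. The expectation at \<open>m\<close> is therefore the average
  with weights \<open>p\<close> and \<open>1 - p\<close> of an explicit quantity (\<open>2 * m - 1\<close> for the black balls, and
  \<open>m / 2 * ln m + O(m)\<close> for the time) and of the expectation at \<open>m - 1\<close>. Such averages only look back
  by \<open>O(sqrt m)\<close> levels, over which both quantities change by a smaller order.
\<close>

section \<open>First-step analysis\<close>

lemma enn2real_nn_integral_nat:
  fixes f :: "'a \<Rightarrow> nat"
  assumes [measurable]: "f \<in> M \<rightarrow>\<^sub>M count_space UNIV"
  shows "(\<integral>x. real (f x) \<partial>M) = enn2real (\<integral>\<^sup>+x. of_nat (f x) \<partial>M)"
  by (subst integral_eq_nn_integral) (auto simp: ennreal_of_nat_eq_real_of_nat)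

lemma enn2real_convex:
  assumes "0 \<le> a" "0 \<le> c" "x < top" "y < top"
  shows "enn2real (ennreal a * x + ennreal c * y) = a * enn2real x + c * enn2real y"
  using assms by (simp add: enn2real_plus ennreal_mult_less_top enn2real_mult)

text \<open>\<open>draw\<close> takes one value on the set \<open>?W\<close> of numbers that select
  a white ball and another on its complement, so the integral is a sum of two values weighted with
  the probabilities of these sets.\<close>

lemma nn_integral_draw:
  assumes "\<not> absorbed (w, b)"
  shows "(\<integral>\<^sup>+u. g (draw u (w, b)) \<partial>uniform_measure lborel {0..<1})
       = ennreal (real w / real (w + b)) * g (w + 1, b - 1) + ennreal (real b / real (w + b)) * g (w - 1, b + 1)"
proof -
  let ?U = "uniform_measure lborel {0..<1::real}"
  let ?W = "{u::real. u * real (w + b) < real w}"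
  interpret U: prob_space ?U
    by (rule prob_space_uniform_measure) auto
  have pos: "0 < w + b"
    using assms by (simp add: absorbed_def)
  have W [measurable]: "?W \<in> sets ?U"
    by simp
  have sp: "space ?U - ?W = - ?W"
    by (auto simp: space_uniform_measure)
  have pW: "emeasure ?U ?W = ennreal (real w / real (w + b))"
    using prob_white[OF pos] by (simp add: U.emeasure_eq_measure)
  have "measure ?U (- ?W) = 1 - real w / real (w + b)"
    using U.prob_compl[OF W] prob_white[OF pos] unfolding sp by simp
  also have "1 - real w / real (w + b) = b / real (w + b)"
  proof -
    have "real w + real b \<noteq> 0" using pos by linarith
    then show ?thesis by (simp add: field_simps)
  qed
  finally have pB: "emeasure ?U (- ?W) = ennreal (real b / real (w + b))"
    by (simp add: U.emeasure_eq_measure)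
  have eq: "g (draw u (w, b)) = g (w + 1, b - 1) * indicator ?W u + g (w - 1, b + 1) * indicator (- ?W) u"
    for u
    using assms by (simp add: draw_def)
  have "(\<integral>\<^sup>+u. g (draw u (w, b)) \<partial>?U)
      = g (w + 1, b - 1) * emeasure ?U ?W + g (w - 1, b + 1) * emeasure ?U (- ?W)"
    unfolding eq by (subst nn_integral_add) (auto simp: nn_integral_cmult_indicator sp[symmetric])
  then show ?thesis
    unfolding pW pB by (simp add: mult.commute)
qed

text \<open>Markov property at the first step: an i.i.d. stream is its head followed by an
  independent stream of the same law. \<open>F\<close> is a functional of the path, and
  \<open>G s\<close> is its continuation from the urn \<open>s\<close> that the first draw
  produces.\<close>

lemma nn_integral_first_draw:
  assumes [measurable]: "F \<in> borel_measurable draws"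
    and F: "\<And>u \<omega>. F (u ## \<omega>) = G (draw u (w, b)) \<omega>"
    and "\<not> absorbed (w, b)"
  shows "(\<integral>\<^sup>+\<omega>. F \<omega> \<partial>draws)
       = ennreal (real w / real (w + b)) * (\<integral>\<^sup>+\<omega>. G (w + 1, b - 1) \<omega> \<partial>draws)
         + ennreal (real b / real (w + b)) * (\<integral>\<^sup>+\<omega>. G (w - 1, b + 1) \<omega> \<partial>draws)"
proof -
  interpret U: prob_space "uniform_measure lborel {0..<1::real}"
    by (rule prob_space_uniform_measure) auto
  have "(\<integral>\<^sup>+\<omega>. F \<omega> \<partial>draws)
      = (\<integral>\<^sup>+u. (\<integral>\<^sup>+\<omega>. F (u ## \<omega>) \<partial>draws) \<partial>uniform_measure lborel {0..<1})"
    using assms(1) unfolding draws_def by (rule U.nn_integral_stream_space)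
  also have "\<dots> = (\<integral>\<^sup>+u. (\<lambda>s. \<integral>\<^sup>+\<omega>. G s \<omega> \<partial>draws) (draw u (w, b)) \<partial>uniform_measure lborel {0..<1})"
    by (simp add: F)
  also have "\<dots> = ennreal (real w / real (w + b)) * (\<integral>\<^sup>+\<omega>. G (w + 1, b - 1) \<omega> \<partial>draws)
         + ennreal (real b / real (w + b)) * (\<integral>\<^sup>+\<omega>. G (w - 1, b + 1) \<omega> \<partial>draws)"
    by (rule nn_integral_draw[where g = "\<lambda>s. \<integral>\<^sup>+\<omega>. G s \<omega> \<partial>draws", OF assms(3)])
  finally show ?thesis .
qed

section \<open>Shift of the path by one draw\<close>

text \<open>The removal after the first draw becomes the removal at time \<open>0\<close> of the
  shifted path; hence the new start is the drawn urn before \<open>p\<close> acts on it.\<close>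

lemma urn_at_SCons: "urn_at p s (u ## \<omega>) (Suc n) = urn_at p (draw u (p s)) \<omega> n"
  by (induction n) auto

text \<open>A finite infimum in \<open>enat\<close> is attained. Comparing times with every
  \<open>n\<close> avoids working with the infimum itself.\<close>

lemma absorption_time_le_iff:
  "absorption_time p s \<omega> \<le> enat n \<longleftrightarrow> (\<exists>m\<le>n. absorbed (urn_at p s \<omega> m))"
proof
  assume "absorption_time p s \<omega> \<le> enat n"
  then have "absorption_time p s \<omega> < enat (Suc n)"
    by (metis enat_ord_simps(2) le_less_trans lessI)
  then show "\<exists>m\<le>n. absorbed (urn_at p s \<omega> m)"
    unfolding absorption_time_def Inf_less_iff by (auto simp: less_Suc_eq_le)
next
  assume "\<exists>m\<le>n. absorbed (urn_at p s \<omega> m)"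
  then show "absorption_time p s \<omega> \<le> enat n"
    unfolding absorption_time_def by (auto intro!: Inf_lower2)
qed

lemma absorption_time_eq_0: "absorbed (p s) \<Longrightarrow> absorption_time p s \<omega> = 0"
  using absorption_time_le_iff[of p s \<omega> 0] by (simp add: enat_0)

lemma enat_eqI_le:
  fixes x y :: enat
  assumes "\<And>n. x \<le> enat n \<longleftrightarrow> y \<le> enat n"
  shows "x = y"
  using assms by (metis antisym enat_ile enat_ord_simps(3) linorder_not_le order_refl enat_ord_code(3) not_infinity_eq)

lemma absorption_time_SCons:
  assumes "\<not> absorbed (p s)"
  shows "absorption_time p s (u ## \<omega>) = eSuc (absorption_time p (draw u (p s)) \<omega>)"
proof (rule enat_eqI_le)
  fix n
  show "absorption_time p s (u ## \<omega>) \<le> enat n \<longleftrightarrow> eSuc (absorption_time p (draw u (p s)) \<omega>) \<le> enat n"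
  proof (cases n)
    case 0
    with assms show ?thesis by (simp add: absorption_time_le_iff enat_0[symmetric]) (simp add: enat_0)
  next
    case (Suc k)
    have "(\<exists>m\<le>Suc k. absorbed (urn_at p s (u ## \<omega>) m)) \<longleftrightarrow> (\<exists>m\<le>k. absorbed (urn_at p (draw u (p s)) \<omega> m))"
      using assms urn_at_SCons by (metis Suc_le_mono not0_implies_Suc urn_at.simps(1))
    then have "absorption_time p s (u ## \<omega>) \<le> enat n \<longleftrightarrow> absorption_time p (draw u (p s)) \<omega> \<le> enat k"
      by (simp only: absorption_time_le_iff Suc)
    then show ?thesis
      by (simp add: Suc eSuc_enat[symmetric])
  qed
qed

lemma final_black_absorbed: "absorbed (p s) \<Longrightarrow> final_black p s \<omega> = snd (p s)"
  by (simp add: final_black_def absorption_time_eq_0 zero_enat_def)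

lemma final_black_SCons:
  assumes "\<not> absorbed (p s)"
  shows "final_black p s (u ## \<omega>) = final_black p (draw u (p s)) \<omega>"
  unfolding final_black_def absorption_time_SCons[of p s, OF assms]
  by (cases "absorption_time p (draw u (p s)) \<omega>") (simp_all add: eSuc_enat urn_at_SCons del: urn_at.simps)

text \<open>The common property of \<open>id\<close> and \<open>policy_A\<close> that makes both
  expectations finite, so that the first-step equations are proved once for both policies.\<close>

definition removes :: "(urn \<Rightarrow> urn) \<Rightarrow> bool" where
  "removes p \<longleftrightarrow> (\<forall>s. fst (p s) \<le> fst s \<and> snd (p s) \<le> snd s)"

lemma removes_id [simp]: "removes id"
  by (simp add: removes_def)

lemma removes_policy_A [simp]: "removes policy_A"
  by (auto simp: removes_def policy_A_def)

lemma expected_black_absorbed: "absorbed (p s) \<Longrightarrow> expected_black p s = snd (p s)"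
  using prob_space.prob_space[OF prob_space_draws]
  by (simp add: expected_black_def final_black_absorbed)

lemma expected_time_absorbed: "absorbed (p s) \<Longrightarrow> expected_time p s = 0"
  by (simp add: expected_time_def absorption_time_eq_0)

lemma urn_size_draw: "fst (draw u s) + snd (draw u s) = fst s + snd s"
  by (cases s) (auto simp: draw_def absorbed_def)

lemma final_black_le:
  assumes "removes p"
  shows "final_black p s \<omega> \<le> fst s + snd s"
proof -
  have "fst (urn_at p s \<omega> n) + snd (urn_at p s \<omega> n) \<le> fst s + snd s" for n
  proof (induction n)
    case 0
    have "fst (p s) \<le> fst s" "snd (p s) \<le> snd s"
      using assms unfolding removes_def by blast+
    then show ?case by simp
  next
    case (Suc n)
    have "fst (urn_at p s \<omega> (Suc n)) + snd (urn_at p s \<omega> (Suc n))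
       \<le> fst (draw (\<omega> !! n) (urn_at p s \<omega> n)) + snd (draw (\<omega> !! n) (urn_at p s \<omega> n))"
      using assms unfolding removes_def by (metis add_mono urn_at.simps(2))
    with Suc show ?case by (simp add: urn_size_draw del: urn_at.simps)
  qed
  then have "snd (urn_at p s \<omega> n) \<le> fst s + snd s" for n
    using add_leD2 by blast
  then show ?thesis
    by (auto simp: final_black_def split: enat.split)
qed

lemma nn_integral_final_black_finite:
  assumes "removes p"
  shows "(\<integral>\<^sup>+\<omega>. of_nat (final_black p s \<omega>) \<partial>draws) < \<infinity>"
proof -
  interpret prob_space draws by (rule prob_space_draws)
  have "(\<integral>\<^sup>+\<omega>. of_nat (final_black p s \<omega>) \<partial>draws) \<le> (\<integral>\<^sup>+\<omega>. of_nat (fst s + snd s) \<partial>draws)"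
    by (intro nn_integral_mono) (metis final_black_le[OF assms] of_nat_le_iff)
  also have "\<dots> < \<infinity>"
    by (simp add: emeasure_space_1 of_nat_less_top del: of_nat_add)
  finally show ?thesis .
qed

text \<open>The urns on the right are those before the removal that follows the draw, since
  \<open>expected_black\<close> itself applies \<open>p\<close> at time \<open>0\<close>. Finiteness
  lets \<open>enn2real\<close> pass through the weighted sum.\<close>

lemma expected_black_step:
  assumes "removes p" "p s = (w, b)" "\<not> absorbed (w, b)"
  shows "expected_black p s = real w / real (w + b) * expected_black p (w + 1, b - 1)
           + real b / real (w + b) * expected_black p (w - 1, b + 1)"
proof -
  have "(\<integral>\<^sup>+\<omega>. of_nat (final_black p s \<omega>) \<partial>draws)
       = ennreal (real w / real (w + b)) * (\<integral>\<^sup>+\<omega>. of_nat (final_black p (w + 1, b - 1) \<omega>) \<partial>draws)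
         + ennreal (real b / real (w + b)) * (\<integral>\<^sup>+\<omega>. of_nat (final_black p (w - 1, b + 1) \<omega>) \<partial>draws)"
    by (rule nn_integral_first_draw[where G = "\<lambda>s \<omega>. of_nat (final_black p s \<omega>)"])
      (use assms in \<open>simp_all add: final_black_SCons\<close>)
  then show ?thesis
    unfolding expected_black_def
    using nn_integral_final_black_finite[OF assms(1)]
    by (simp add: enn2real_nn_integral_nat enn2real_convex)
qed

section \<open>Finiteness of the expected absorption time\<close>

lemma min_eSuc: "min (eSuc x) (eSuc y) = eSuc (min x y)"
  by (simp add: min_def)

text \<open>A Lyapunov argument. The time truncated at \<open>n\<close> is bounded by induction on
  \<open>n\<close>, and monotone convergence removes the truncation.\<close>

lemma nn_integral_absorption_time_le:
  fixes g :: "urn \<Rightarrow> real"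
  assumes g: "\<And>s w b. p s = (w, b) \<Longrightarrow> \<not> absorbed (w, b) \<Longrightarrow>
      1 + real w / real (w + b) * g (w + 1, b - 1) + real b / real (w + b) * g (w - 1, b + 1) \<le> g s"
    and nonneg: "\<And>s. 0 \<le> g s"
  shows "(\<integral>\<^sup>+\<omega>. ennreal_of_enat (absorption_time p s \<omega>) \<partial>draws) \<le> ennreal (g s)"
proof -
  interpret prob_space draws by (rule prob_space_draws)
  let ?F = "\<lambda>n s \<omega>. ennreal_of_enat (min (absorption_time p s \<omega>) (enat n))"
  have trunc: "(\<integral>\<^sup>+\<omega>. ?F n s \<omega> \<partial>draws) \<le> ennreal (g s)" for n s
  proof (induction n arbitrary: s)
    case 0
    then show ?case by (simp add: enat_0)
  next
    case (Suc n)
    obtain w b where wb: "p s = (w, b)" by fastforce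
    show ?case
    proof (cases "absorbed (w, b)")
      case True
      with wb show ?thesis by (simp add: absorption_time_eq_0)
    next
      case False
      then have pos: "0 < real (w + b)" by (auto simp: absorbed_def)
      have *: "(\<integral>\<^sup>+\<omega>. 1 + ?F n t \<omega> \<partial>draws) \<le> ennreal (1 + g t)" for t
        using Suc.IH[of t] nonneg[of t]
        by (subst nn_integral_add) (auto simp: emeasure_space_1 ennreal_plus intro: add_left_mono)
      have "(\<integral>\<^sup>+\<omega>. ?F (Suc n) s \<omega> \<partial>draws)
          = ennreal (real w / real (w + b)) * (\<integral>\<^sup>+\<omega>. 1 + ?F n (w + 1, b - 1) \<omega> \<partial>draws)
            + ennreal (real b / real (w + b)) * (\<integral>\<^sup>+\<omega>. 1 + ?F n (w - 1, b + 1) \<omega> \<partial>draws)"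
        using False wb
        by (intro nn_integral_first_draw[where G = "\<lambda>s \<omega>. 1 + ?F n s \<omega>"])
          (simp_all add: absorption_time_SCons eSuc_enat[symmetric] min_eSuc flip: ennreal_of_enat_eSuc)
      also have "\<dots> \<le> ennreal (real w / real (w + b)) * ennreal (1 + g (w + 1, b - 1))
            + ennreal (real b / real (w + b)) * ennreal (1 + g (w - 1, b + 1))"
        by (intro add_mono mult_left_mono *) simp_all
      also have "\<dots> = ennreal (real w / real (w + b) * (1 + g (w + 1, b - 1)) + real b / real (w + b) * (1 + g (w - 1, b + 1)))"
        using nonneg by (subst ennreal_plus) (auto simp: ennreal_mult simp del: of_nat_add ennreal_plus times_divide_eq_left)
      also have "\<dots> = ennreal (1 + real w / real (w + b) * g (w + 1, b - 1) + real b / real (w + b) * g (w - 1, b + 1))"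
        using pos by (simp add: divide_simps) (simp add: algebra_simps)
      also have "\<dots> \<le> ennreal (g s)"
        using g[OF wb False] by (rule ennreal_leI)
      finally show ?thesis .
    qed
  qed
  have "(SUP n. min x (enat n)) = x" for x :: enat
  proof (rule antisym)
    show "x \<le> (SUP n. min x (enat n))"
    proof (cases x)
      case (enat m)
      then show ?thesis by (intro SUP_upper2[of m]) auto
    next
      case infinity
      show ?thesis
      proof (cases "SUP n. min x (enat n)")
        case (enat m)
        have "min x (enat (Suc m)) \<le> (SUP n. min x (enat n))"
          by (rule SUP_upper) simp
        with enat infinity show ?thesis by simp
      qed simp
    qed
  qed (auto intro: SUP_least)
  then have SUP_min: "ennreal_of_enat x = (SUP n. ennreal_of_enat (min x (enat n)))" for x
    using ennreal_of_enat_Sup[of "range (\<lambda>n. min x (enat n))"] by (simp add: image_comp comp_def)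
  then have "(\<integral>\<^sup>+\<omega>. ennreal_of_enat (absorption_time p s \<omega>) \<partial>draws)
      = (\<integral>\<^sup>+\<omega>. (SUP n. ?F n s \<omega>) \<partial>draws)"
    by (intro nn_integral_cong SUP_min)
  also have "\<dots> = (SUP n. \<integral>\<^sup>+\<omega>. ?F n s \<omega> \<partial>draws)"
    by (intro nn_integral_monotone_convergence_SUP incseq_SucI)
      (auto simp: le_fun_def intro: min.coboundedI2)
  also have "\<dots> \<le> ennreal (g s)"
    by (intro SUP_least trunc)
  finally show ?thesis .
qed

lemma nn_integral_absorption_time_finite:
  assumes "removes p"
  shows "(\<integral>\<^sup>+\<omega>. ennreal_of_enat (absorption_time p s \<omega>) \<partial>draws) < \<infinity>"
proof -
  \<comment> \<open>With \<open>N\<close> balls, \<open>g\<close> is \<open>2 * (N ^ N - N ^ b)\<close>: a black draw multiplies \<open>N ^ b\<close> by \<open>N\<close>, which outweighs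
    the effect of a white draw although its probability may be as small as \<open>1 / N\<close>.\<close>
  define g :: "urn \<Rightarrow> real" where
    "g = (\<lambda>(w, b). 2 * real (w + b) ^ b * (real (w + b) ^ w - 1))"
  \<comment> \<open>The bound is wanted at \<open>s\<close>, but the draw is made from
    \<open>p s\<close>, which has no more balls of either colour.\<close>
  have mono: "g (w, b) \<le> g (w', b')" if "w \<le> w'" "b \<le> b'" "0 < w" "0 < b" for w b w' b'
  proof -
    have 1: "real (w + b) ^ b \<le> real (w' + b') ^ b'"
      using that by (intro power_mono power_increasing order_trans[OF power_mono[of _ "real (w' + b')"] power_increasing]) auto
    have 2: "real (w + b) ^ w \<le> real (w' + b') ^ w'"
      using that by (intro order_trans[OF power_mono[of _ "real (w' + b')"] power_increasing]) auto
    have "1 \<le> real (w + b) ^ w"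
      using that by (intro one_le_power) auto
    with 1 2 show ?thesis
      unfolding g_def by (auto intro!: mult_mono)
  qed
  have nonneg: "0 \<le> g s" for s
  proof (cases s)
    case (Pair w b)
    have "w = 0 \<or> 1 \<le> real (w + b) ^ w"
      by (cases "w = 0") (auto intro!: one_le_power)
    with Pair show ?thesis by (auto simp: g_def)
  qed
  have step: "1 + real w / real (w + b) * g (w + 1, b - 1) + real b / real (w + b) * g (w - 1, b + 1) \<le> g (w, b)"
    if "0 < w" "0 < b" for w b
  proof -
    define N where "N = real (w + b)"
    obtain v c where vc: "w = Suc v" "b = Suc c"
      using \<open>0 < w\<close> \<open>0 < b\<close> by (metis gr0_conv_Suc)
    have N2: "2 \<le> N" and Nb: "N = real w + real b" using vc by (auto simp: N_def)
    have Npos: "0 < N" using N2 by simp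
    have P: "1 \<le> N ^ c" using N2 by (intro one_le_power) auto
    have g1: "g (w + 1, b - 1) = 2 * (N ^ (w + b) - N ^ c)"
      and g2: "g (w - 1, b + 1) = 2 * (N ^ (w + b) - N ^ c * N * N)"
      and g0: "g (w, b) = 2 * (N ^ (w + b) - N ^ c * N)"
      unfolding g_def N_def vc by (simp_all add: right_diff_distrib power_add algebra_simps)
    \<comment> \<open>The surplus of \<open>g\<close>, multiplied by \<open>N\<close>. It is
      nonnegative by \<open>N \<le> 2 * (N - 1)\<close>, \<open>1 \<le> N ^ c\<close> and
      \<open>b * N - w \<ge> N - w = b \<ge> 1\<close>.\<close>
    have "N * (g (w, b) - (1 + w / N * g (w + 1, b - 1) + b / N * g (w - 1, b + 1)))
        = 2 * N ^ c * (N - 1) * (b * N - w) - N"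
    proof -
      have 1: "N * (1 + w / N * x + b / N * y) = N + w * x + b * y" for x y :: real
        using Npos by (simp add: distrib_left)
      have 2: "(v + u) * (2 * (R - Q * (v + u))) - ((v + u) + v * (2 * (R - Q)) + u * (2 * (R - Q * (v + u) * (v + u))))
         = 2 * Q * (v + u - 1) * (u * (v + u) - v) - (v + u)" for u v Q R :: real
        by algebra
      show ?thesis
        unfolding right_diff_distrib[of N] 1 g0 g1 g2 using 2[of "real w" "real b"] Nb by simp
    qed
    moreover have "N \<le> 2 * N ^ c * (N - 1) * (b * N - w)"
    proof -
      have "N \<le> 2 * (N - 1)" using N2 by simp
      also have "\<dots> \<le> 2 * N ^ c * (N - 1)" using mult_left_mono[OF P, of "2 * (N - 1)"] N2 by (simp add: algebra_simps)
      also have "\<dots> \<le> 2 * N ^ c * (N - 1) * (b * N - w)"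
      proof -
        have "1 * N \<le> real b * N" using \<open>0 < b\<close> Npos by (intro mult_right_mono) auto
        moreover have "1 \<le> real b" using \<open>0 < b\<close> by simp
        ultimately have "1 \<le> b * N - w" using Nb by linarith
        then have "2 * N ^ c * (N - 1) * 1 \<le> 2 * N ^ c * (N - 1) * (b * N - w)"
          using N2 P by (intro mult_left_mono mult_nonneg_nonneg) auto
        then show ?thesis by simp
      qed
      finally show ?thesis .
    qed
    ultimately have "0 \<le> N * (g (w, b) - (1 + w / N * g (w + 1, b - 1) + b / N * g (w - 1, b + 1)))"
      by simp
    then show ?thesis
      using Npos unfolding N_def[symmetric] zero_le_mult_iff by simp
  qed
  have "(\<integral>\<^sup>+\<omega>. ennreal_of_enat (absorption_time p s \<omega>) \<partial>draws) \<le> ennreal (g s)"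
  proof (rule nn_integral_absorption_time_le[OF _ nonneg])
    fix s w b assume s: "p s = (w, b)" "\<not> absorbed (w, b)"
    then have pos: "0 < w" "0 < b" by (auto simp: absorbed_def)
    have "w \<le> fst s" "b \<le> snd s"
      using assms s unfolding removes_def by (metis fst_conv, metis snd_conv)
    then have "g (w, b) \<le> g s"
      using mono[of w "fst s" b "snd s"] pos by simp
    with step[OF pos] show "1 + real w / real (w + b) * g (w + 1, b - 1) + real b / real (w + b) * g (w - 1, b + 1) \<le> g s"
      by linarith
  qed
  then show ?thesis
    by (simp add: le_less_trans)
qed

lemma expected_time_step:
  assumes "removes p" "p s = (w, b)" "\<not> absorbed (w, b)"
  shows "expected_time p s = 1 + real w / real (w + b) * expected_time p (w + 1, b - 1)
           + real b / real (w + b) * expected_time p (w - 1, b + 1)"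
proof -
  interpret prob_space draws by (rule prob_space_draws)
  let ?F = "\<lambda>s. \<integral>\<^sup>+\<omega>. ennreal_of_enat (absorption_time p s \<omega>) \<partial>draws"
  have pos: "0 < real (w + b)"
    using assms(3) by (auto simp: absorbed_def)
  have add: "(\<integral>\<^sup>+\<omega>. 1 + ennreal_of_enat (absorption_time p t \<omega>) \<partial>draws) = 1 + ?F t" for t
    by (subst nn_integral_add) (auto simp: emeasure_space_1)
  have fin: "1 + ?F t < top" "enn2real (1 + ?F t) = 1 + expected_time p t" for t
    using nn_integral_absorption_time_finite[OF assms(1), of t]
    by (auto simp: expected_time_def enn2real_plus)
  have "?F s = ennreal (real w / real (w + b)) * (1 + ?F (w + 1, b - 1)) + ennreal (real b / real (w + b)) * (1 + ?F (w - 1, b + 1))"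
    unfolding add[symmetric]
    by (rule nn_integral_first_draw[where G = "\<lambda>s \<omega>. 1 + ennreal_of_enat (absorption_time p s \<omega>)"])
      (use assms in \<open>simp_all add: absorption_time_SCons\<close>)
  then have "expected_time p s = real w / real (w + b) * (1 + expected_time p (w + 1, b - 1))
       + real b / real (w + b) * (1 + expected_time p (w - 1, b + 1))"
    unfolding expected_time_def[of p s] by (simp only:) (simp only: enn2real_convex[OF _ _ fin(1) fin(1)] fin(2) divide_nonneg_nonneg of_nat_0_le_iff)
  then show ?thesis
    using pos by (simp add: divide_simps) (simp add: algebra_simps)
qed

lemma urn_at_idem:
  assumes "p (p s) = p s"
  shows "urn_at p (p s) \<omega> n = urn_at p s \<omega> n"
  by (induction n) (simp_all add: assms)

text \<open>Serves to identify an urn with what Policy A leaves of it: \<open>(k, k)\<close> with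
  \<open>(k - 1, k)\<close>, and \<open>(m, m - 1)\<close> with
  \<open>(m - 2, m - 1)\<close>.\<close>

lemma expected_idem:
  assumes "p (p s) = p s"
  shows "expected_black p (p s) = expected_black p s" "expected_time p (p s) = expected_time p s"
  by (simp_all add: expected_black_def expected_time_def final_black_def absorption_time_def
      urn_at_idem[of p s, OF assms] cong: enat.case_cong)

lemma policy_A_idem: "policy_A (policy_A s) = policy_A s"
  by (auto simp: policy_A_def split: prod.splits)

lemma policy_A_less: "w < b \<Longrightarrow> policy_A (w, b) = (w, b)"
  by (simp add: policy_A_def)

lemma policy_A_ge: "0 < b \<Longrightarrow> b \<le> w \<Longrightarrow> policy_A (w, b) = (b - 1, b)"
  by (simp add: policy_A_def)

section \<open>Growth of solutions of the difference equations\<close>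

text \<open>The decreases of the potential \<open>g\<close> telescope, and its last value is dropped
  by its sign. This turns the contraction rate of a recursion into a bound on a tail sum.\<close>

lemma telescoping_sum_le:
  fixes g h :: "nat \<Rightarrow> real"
  assumes step: "\<And>j. J < j \<Longrightarrow> j < n \<Longrightarrow> D * h j \<le> N * (g (j - 1) - g j)"
    and "0 \<le> N" "J < n" "0 \<le> g (n - 1)"
  shows "D * (\<Sum>j\<in>{J<..<n}. h j) \<le> N * g J"
proof -
  have "D * (\<Sum>j\<in>{J<..<m}. h j) \<le> N * (g J - g (m - 1))" if "Suc J \<le> m" "m \<le> n" for m
    using that
  proof (induction m rule: dec_induct)
    case base
    then show ?case by (simp flip: atLeastSucLessThan_greaterThanLessThan)
  next
    case (step m)
    have "{J<..<Suc m} = insert m {J<..<m}" using step by auto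
    then have "D * (\<Sum>j\<in>{J<..<Suc m}. h j) = D * h m + D * (\<Sum>j\<in>{J<..<m}. h j)"
      by (simp add: algebra_simps)
    also have "\<dots> \<le> N * (g (m - 1) - g m) + N * (g J - g (m - 1))"
      using step assms(1)[of m] by (intro add_mono) auto
    finally show ?case by (simp add: algebra_simps)
  qed
  from this[of n] assms have "D * (\<Sum>j\<in>{J<..<n}. h j) \<le> N * (g J - g (n - 1))"
    by simp
  also have "\<dots> \<le> N * g J"
    using assms by (intro mult_left_mono) auto
  finally show ?thesis .
qed

text \<open>Both follow from \<open>ln x \<le> x - 1\<close>, at \<open>x = k / (k + 1)\<close> and
  at its reciprocal.\<close>

lemma ln_diff_bounds:
  assumes "0 < k"
  shows "1 / (real k + 1) \<le> ln (real k + 1) - ln k" "ln (real k + 1) - ln k \<le> 1 / real k"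
proof -
  have "ln (real k / (real k + 1)) \<le> real k / (real k + 1) - 1"
    using assms by (intro ln_le_minus_one) simp
  then show "1 / (real k + 1) \<le> ln (real k + 1) - ln k"
    using assms by (simp add: ln_div field_simps)
  have "ln ((real k + 1) / real k) \<le> (real k + 1) / real k - 1"
    using assms by (intro ln_le_minus_one) simp
  then show "ln (real k + 1) - ln k \<le> 1 / real k"
    using assms by (simp add: ln_div field_simps)
qed

lemma harmonic_sum_bounds:
  assumes "0 < J" "J < n"
  shows "ln n - ln (real J + 1) \<le> (\<Sum>j\<in>{J<..<n}. 1 / real j)"
    and "(\<Sum>j\<in>{J<..<n}. 1 / real j) \<le> ln (real n - 1) - ln J"
proof -
  have "Suc J \<le> n" using assms by simp
  then have "ln n - ln (real J + 1) \<le> (\<Sum>j\<in>{J<..<n}. 1 / real j)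
      \<and> (\<Sum>j\<in>{J<..<n}. 1 / real j) \<le> ln (real n - 1) - ln J"
  proof (induction n rule: dec_induct)
    case base
    then show ?case by (simp add: add.commute flip: atLeastSucLessThan_greaterThanLessThan)
  next
    case (step m)
    have "{J<..<Suc m} = insert m {J<..<m}" using step by auto
    then have *: "(\<Sum>j\<in>{J<..<Suc m}. 1 / real j) = 1 / real m + (\<Sum>j\<in>{J<..<m}. 1 / real j)"
      by simp
    have "1 / real m \<le> ln m - ln (real m - 1)"
      using ln_diff_bounds(1)[of "m - 1"] step assms by (simp add: of_nat_diff)
    moreover have "ln (real m + 1) - ln m \<le> 1 / real m"
      using ln_diff_bounds(2)[of m] step by simp
    ultimately show ?case using step.IH unfolding * by (simp add: add.commute)
  qed
  then show "ln n - ln (real J + 1) \<le> (\<Sum>j\<in>{J<..<n}. 1 / real j)"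
    and "(\<Sum>j\<in>{J<..<n}. 1 / real j) \<le> ln (real n - 1) - ln J" by auto
qed

text \<open>Each level adds a drift of at most \<open>d m\<close> to the deviation from
  \<open>L\<close>, and averaging with weight \<open>p m\<close> shrinks what was accumulated. The
  two balance at about \<open>d m / p m\<close>, which is at most
  \<open>4 * sqrt m * d m\<close>.\<close>

lemma weighted_average_deviation:
  fixes S A L p c d :: "nat \<Rightarrow> real"
  assumes S: "\<And>m. 2 \<le> m \<Longrightarrow> S m = p m * A m + (1 - p m) * S (m - 1)"
    and p: "\<And>m. 2 \<le> m \<Longrightarrow> 1 / (4 * sqrt m) \<le> p m" "\<And>m. 2 \<le> m \<Longrightarrow> p m \<le> 1"
    and A: "\<And>m. 2 \<le> m \<Longrightarrow> \<bar>A m - L m\<bar> \<le> c m"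
    and L: "\<And>m. 2 \<le> m \<Longrightarrow> \<bar>L m - L (m - 1)\<bar> \<le> d m"
    and c: "\<And>m. 1 \<le> m \<Longrightarrow> c m \<le> c (Suc m)"
    and d: "\<And>m. 1 \<le> m \<Longrightarrow> d m \<le> d (Suc m)" "\<And>m. 1 \<le> m \<Longrightarrow> 0 \<le> d m"
    and base: "\<bar>S 1 - L 1\<bar> \<le> c 1"
    and "1 \<le> m"
  shows "\<bar>S m - L m\<bar> \<le> c m + 4 * sqrt m * d m"
  using \<open>1 \<le> m\<close>
proof (induction m rule: dec_induct)
  case base
  then show ?case using \<open>\<bar>S 1 - L 1\<bar> \<le> c 1\<close> d(2)[of 1] by simp
next
  case (step m)
  let ?m = "Suc m"
  define q where "q = p ?m"
  have m2: "2 \<le> ?m" using step by simp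
  have q: "0 \<le> q" "q \<le> 1" "1 \<le> q * (4 * sqrt ?m)"
    using p[OF m2] order_trans[of 0 "1 / (4 * sqrt ?m)" "p ?m"] by (auto simp: q_def field_simps)
  \<comment> \<open>Chosen so that \<open>q * X\<close>, the part of \<open>X\<close> that averaging
    takes off, covers the new drift \<open>d ?m\<close>.\<close>
  define X where "X = 4 * sqrt ?m * d ?m"
  have "d ?m * 1 \<le> d ?m * (q * (4 * sqrt ?m))"
    using q(3) d(2)[of ?m] by (intro mult_left_mono) auto
  then have dX: "d ?m \<le> q * X" by (simp add: X_def mult_ac)
  have "4 * sqrt m * d m \<le> X"
    unfolding X_def using d[of m] step by (intro mult_mono) auto
  then have IH: "\<bar>S m - L m\<bar> \<le> c ?m + X"
    using step c[of m] by simp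
  have "S ?m - L ?m = q * (A ?m - L ?m) + (1 - q) * ((S m - L m) - (L ?m - L m))"
    using S[OF m2] by (simp add: q_def algebra_simps)
  also have "\<bar>\<dots>\<bar> \<le> q * \<bar>A ?m - L ?m\<bar> + (1 - q) * (\<bar>S m - L m\<bar> + \<bar>L ?m - L m\<bar>)"
    using q by (intro order_trans[OF abs_triangle_ineq] add_mono) (auto simp: abs_mult intro!: mult_left_mono)
  also have "\<dots> \<le> q * c ?m + (1 - q) * ((c ?m + X) + d ?m)"
    using A[OF m2] L[OF m2] IH q by (intro add_mono mult_left_mono) auto
  also have "\<dots> = c ?m + X + d ?m - q * X - q * d ?m"
    by (simp add: algebra_simps)
  also have "\<dots> \<le> c ?m + X"
    using dX q d(2)[of ?m] mult_nonneg_nonneg[of q "d ?m"] by linarith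
  finally show ?case by (simp add: X_def)
qed

lemma floor_sqrt_bounds:
  assumes "1 \<le> n"
  shows "1 \<le> floor_sqrt n" "real (floor_sqrt n) \<le> sqrt n" "sqrt n < real (floor_sqrt n) + 1"
proof -
  have "(floor_sqrt n)\<^sup>2 \<le> n" by simp
  then show "real (floor_sqrt n) \<le> sqrt n"
    by (intro real_le_rsqrt) (metis of_nat_le_iff of_nat_power)
  have "n < (Suc (floor_sqrt n))\<^sup>2" by (rule Suc_floor_sqrt_power2_gt)
  then have "real n < (real (Suc (floor_sqrt n)))\<^sup>2"
    by (metis of_nat_less_iff of_nat_power)
  then have "sqrt n < real (Suc (floor_sqrt n))"
    by (intro real_less_lsqrt) simp_all
  then show "sqrt n < real (floor_sqrt n) + 1" by simp
  show "1 \<le> floor_sqrt n" using assms by (simp add: le_floor_sqrt_iff Suc_le_eq)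
qed

lemma floor_sqrt_less:
  assumes "2 \<le> n"
  shows "floor_sqrt n < n"
proof (rule ccontr)
  assume "\<not> floor_sqrt n < n"
  then have "n\<^sup>2 \<le> (floor_sqrt n)\<^sup>2"
    by (intro power_mono) auto
  also have "\<dots> \<le> n" by simp
  finally show False
    using mult_le_mono1[OF assms, of n] assms by (simp add: power2_eq_square)
qed

text \<open>The ratios \<open>(m - i) / (m - 1 + i)\<close> make \<open>B i\<close> decay roughly
  like \<open>exp (- i\<^sup>2 / m)\<close>, so the sum has order at most \<open>sqrt m\<close>. The
  terms up to \<open>sqrt m\<close> are bounded by \<open>1\<close>, the later ones by
  telescoping.\<close>

lemma excursion_sum_bounds:
  fixes B :: "nat \<Rightarrow> real"
  assumes B0: "B 0 = 1"
    and B: "\<And>i. 1 \<le> i \<Longrightarrow> i < m \<Longrightarrow> (real m - 1 + real i) * B i = (real m - real i) * B (i - 1)"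
    and "2 \<le> m"
  shows "1 \<le> (\<Sum>i<m. B i)" "(\<Sum>i<m. B i) \<le> 4 * sqrt m"
proof -
  have bounds: "0 \<le> B i \<and> B i \<le> 1" if "i < m" for i
    using that
  proof (induction i)
    case 0
    then show ?case by (simp add: B0)
  next
    case (Suc i)
    define r where "r = (real m - real (Suc i)) / (real m - 1 + real (Suc i))"
    have eq: "B (Suc i) = r * B i"
      using B[of "Suc i"] Suc by (simp add: r_def field_simps)
    have "0 \<le> r" "r \<le> 1"
      using Suc by (auto simp: r_def field_simps)
    with Suc show ?case unfolding eq by (intro conjI mult_nonneg_nonneg mult_le_one) auto
  qed
  have "B 0 \<le> (\<Sum>i<m. B i)"
    using bounds \<open>2 \<le> m\<close> by (intro member_le_sum) auto
  then show "1 \<le> (\<Sum>i<m. B i)" by (simp add: B0)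
  define J where "J = floor_sqrt m"
  have J: "1 \<le> J" "J \<le> sqrt m" "sqrt m < J + 1"
    using floor_sqrt_bounds[of m] \<open>2 \<le> m\<close> by (auto simp: J_def)
  have "J < m"
    unfolding J_def using \<open>2 \<le> m\<close> by (rule floor_sqrt_less)
  have "(2 * real J + 1) * (\<Sum>i\<in>{J<..<m}. B i) \<le> (2 * real m - 1) * B J"
  proof (rule telescoping_sum_le)
    fix i assume i: "J < i" "i < m"
    \<comment> \<open>The recursion rewritten so that the decrease of \<open>B\<close> controls
      \<open>B\<close> itself; beyond \<open>J\<close> the factor \<open>2 * i - 1\<close> is at
      least \<open>2 * J + 1\<close>.\<close>
    have "(2 * real m - 1) * (B (i - 1) - B i) = (2 * real i - 1) * (B (i - 1) + B i)"
      using B[of i] i J by (simp add: algebra_simps)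
    also have "\<dots> \<ge> (2 * real J + 1) * B i"
      using bounds[of i] bounds[of "i - 1"] i by (intro mult_mono) auto
    finally show "(2 * real J + 1) * B i \<le> (2 * real m - 1) * (B (i - 1) - B i)" .
  qed (use bounds[of "m - 1"] \<open>2 \<le> m\<close> \<open>J < m\<close> in auto)
  also have "\<dots> \<le> 2 * real m * 1"
    using bounds[OF \<open>J < m\<close>] \<open>2 \<le> m\<close> by (intro mult_mono) auto
  finally have le: "(2 * real J + 1) * (\<Sum>i\<in>{J<..<m}. B i) \<le> 2 * real m" by simp
  have nn: "0 \<le> (\<Sum>i\<in>{J<..<m}. B i)"
    using bounds by (intro sum_nonneg) auto
  have "sqrt m * (\<Sum>i\<in>{J<..<m}. B i) \<le> (2 * real J + 1) * (\<Sum>i\<in>{J<..<m}. B i)"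
    using J nn by (intro mult_right_mono) auto
  also note le
  also have "2 * real m = sqrt m * (2 * sqrt m)"
    by simp
  finally have tail: "(\<Sum>i\<in>{J<..<m}. B i) \<le> 2 * sqrt m"
    using \<open>2 \<le> m\<close> by (simp add: mult_le_cancel_left_pos)
  have "{..<m} = {..J} \<union> {J<..<m}" using \<open>J < m\<close> by auto
  then have "(\<Sum>i<m. B i) = (\<Sum>i\<le>J. B i) + (\<Sum>i\<in>{J<..<m}. B i)"
    by (simp add: sum.union_disjoint ivl_disj_int)
  also have "(\<Sum>i\<le>J. B i) \<le> (\<Sum>i\<le>J. 1)"
    using bounds \<open>J < m\<close> by (intro sum_mono) auto
  also have "(\<Sum>i\<le>J. 1) = real J + 1" by simp
  also have "real J + 1 \<le> 2 * sqrt m" using J by linarith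
  finally show "(\<Sum>i<m. B i) \<le> 4 * sqrt m" using tail by simp
qed

text \<open>Covers both chains: \<open>2 * n - \<epsilon>\<close> is the number of balls, with
  \<open>\<epsilon> = 0\<close> without removals and \<open>\<epsilon> = 1\<close> under Policy A.
  Above \<open>sqrt n\<close> the terms are close to \<open>n / j\<close>, and the harmonic sum from
  \<open>sqrt n\<close> to \<open>n\<close> is \<open>ln n / 2\<close> up to a constant.\<close>

lemma log_growth:
  fixes e :: "nat \<Rightarrow> real" and \<epsilon> :: real
  assumes "2 \<le> n" and \<epsilon>: "0 \<le> \<epsilon>" "\<epsilon> \<le> 1" and e0: "0 \<le> e 0" "e 0 \<le> 2"
    and e: "\<And>j. 1 \<le> j \<Longrightarrow> j < n \<Longrightarrow>
      (real n + real j - \<epsilon>) * e j = (2 * real n - \<epsilon>) + (real n - real j) * e (j - 1)"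
  shows "\<bar>(\<Sum>j<n. e j) - real n / 2 * ln n\<bar> \<le> 50 * real n"
proof -
  have bounds: "0 \<le> e j \<and> e j \<le> 2 * real j + 2" if "j < n" for j
    using that
  proof (induction j)
    case 0
    then show ?case using e0 by simp
  next
    case (Suc i)
    define j where "j = real (Suc i)"
    have j: "1 \<le> j" "j < n" using Suc by (auto simp: j_def)
    have IH: "0 \<le> e i" "e i \<le> 2 * j" using Suc by (auto simp: j_def)
    have eq: "(n + j - \<epsilon>) * e (Suc i) = (2 * n - \<epsilon>) + (n - j) * e i"
      using e[of "Suc i"] Suc by (simp add: j_def)
    have pos: "0 < n + j - \<epsilon>" using \<epsilon> j by simp
    have "0 \<le> (n + j - \<epsilon>) * e (Suc i)"
      unfolding eq using IH j \<epsilon> by (intro add_nonneg_nonneg mult_nonneg_nonneg) auto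
    then have 1: "0 \<le> e (Suc i)" using pos by (simp add: zero_le_mult_iff)
    have "(n + j - \<epsilon>) * e (Suc i) \<le> (2 * n - \<epsilon>) + (n - j) * (2 * j)"
      unfolding eq using IH j by (intro add_left_mono mult_left_mono) auto
    also have "\<dots> = (n + j - \<epsilon>) * (2 * j + 2) - (2 * j + 1) * (2 * j - \<epsilon>)"
      by (simp add: algebra_simps)
    also have "\<dots> \<le> (n + j - \<epsilon>) * (2 * j + 2)"
      using j \<epsilon> by simp
    finally have "e (Suc i) \<le> 2 * j + 2" using pos by (simp add: mult_le_cancel_left_pos)
    with 1 show ?case by (simp add: j_def)
  qed
  define J where "J = floor_sqrt n"
  have J: "1 \<le> J" "real J \<le> sqrt n" "sqrt n < real J + 1" and "J < n"
    using floor_sqrt_bounds[of n] floor_sqrt_less[of n] \<open>2 \<le> n\<close> by (auto simp: J_def)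
  have J2: "real J * real J \<le> n"
    using mult_mono[OF J(2) J(2)] by simp
  have "sqrt n * sqrt n \<le> (2 * real J) * (2 * real J)"
    using J by (intro mult_mono) auto
  then have n4: "n \<le> 4 * real J * real J" by simp
  define N where "N = 2 * real n - \<epsilon>"
  have N: "0 \<le> N" "N \<le> 2 * n" using \<epsilon> \<open>2 \<le> n\<close> by (auto simp: N_def)
  \<comment> \<open>\<open>l j\<close> is the fixed point of the \<open>j\<close>-th step of the recursion. Each step contracts the distance
    to it, by a rate that suffices for \<open>j > J\<close>; for \<open>j \<le> J\<close> the linear bound on \<open>e j\<close> is enough.\<close>
  define l where "l j = N / (2 * real j - \<epsilon>)" for j :: nat
  have l_nonneg: "0 \<le> l j" if "1 \<le> j" for j
    using that N \<epsilon> by (auto simp: l_def)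
  have l_anti: "l j \<le> l (j - 1)" if "2 \<le> j" for j
    unfolding l_def using that N \<epsilon> by (intro divide_left_mono) auto
  have l_eq: "(2 * real j - \<epsilon>) * l j = N" if "1 \<le> j" for j
    using that \<epsilon> by (simp add: l_def)
  \<comment> \<open>The potential adds \<open>l j\<close> to the distance because the fixed point
    itself moves down by \<open>l (j - 1) - l j\<close> in each step.\<close>
  have "real J * (\<Sum>j\<in>{J<..<n}. \<bar>e j - l j\<bar>) \<le> N * (\<bar>e J - l J\<bar> + l J)"
  proof (rule telescoping_sum_le)
    fix j assume j: "J < j" "j < n"
    define X where "X = \<bar>e (j - 1) - l (j - 1)\<bar> + (l (j - 1) - l j)"
    have X: "\<bar>e (j - 1) - l j\<bar> \<le> X" "0 \<le> X"
      using l_anti[of j] j J by (auto simp: X_def)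
    have "(real n + real j - \<epsilon>) * (e j - l j) = (real n - real j) * (e (j - 1) - l j)"
      using e[of j] l_eq[of j] j J by (simp add: N_def algebra_simps)
    then have "\<bar>real n + real j - \<epsilon>\<bar> * \<bar>e j - l j\<bar> = \<bar>real n - real j\<bar> * \<bar>e (j - 1) - l j\<bar>"
      unfolding abs_mult[symmetric] by (rule arg_cong)
    then have "(real n + real j - \<epsilon>) * \<bar>e j - l j\<bar> = (real n - real j) * \<bar>e (j - 1) - l j\<bar>"
      using j \<epsilon> by (simp add: abs_of_nonneg)
    also have "\<dots> \<le> (real n - real j) * X"
      using X j by (intro mult_left_mono) auto
    \<comment> \<open>The factor on the left side, \<open>n + j - \<epsilon>\<close>, is
      \<open>N / 2\<close> plus half of \<open>2 * j - \<epsilon>\<close>; the second part is the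
      gain from contraction.\<close>
    also have "\<dots> \<le> N / 2 * X"
      using X j J \<epsilon> by (intro mult_right_mono) (auto simp: N_def field_simps)
    finally have "(2 * real j - \<epsilon>) * \<bar>e j - l j\<bar> \<le> N * (X - \<bar>e j - l j\<bar>)"
      by (simp add: N_def algebra_simps)
    moreover have "real J * \<bar>e j - l j\<bar> \<le> (2 * real j - \<epsilon>) * \<bar>e j - l j\<bar>"
      using j J \<epsilon> by (intro mult_right_mono) auto
    ultimately show "real J * \<bar>e j - l j\<bar>
        \<le> N * (\<bar>e (j - 1) - l (j - 1)\<bar> + l (j - 1) - (\<bar>e j - l j\<bar> + l j))"
      by (simp add: X_def algebra_simps)
  qed (use N \<open>J < n\<close> \<open>2 \<le> n\<close> l_nonneg[of "n - 1"] in auto)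
  \<comment> \<open>\<open>e J \<le> 4 * J\<close> and \<open>l J \<le> 8 * J\<close>, so the
    potential is at most \<open>e J + 2 * l J \<le> 20 * J\<close>.\<close>
  also have "\<dots> \<le> (2 * real n) * (20 * real J)"
  proof (rule mult_mono)
    have "l J \<le> 2 * real n / real J"
      unfolding l_def using N \<epsilon> J by (intro frac_le) auto
    also have "\<dots> \<le> 8 * real J"
      using n4 J by (simp add: field_simps)
    finally show "\<bar>e J - l J\<bar> + l J \<le> 20 * real J"
      using bounds[OF \<open>J < n\<close>] l_nonneg[OF J(1)] J by (auto simp: abs_if)
  qed (use N l_nonneg[OF J(1)] in auto)
  finally have "real J * (\<Sum>j\<in>{J<..<n}. \<bar>e j - l j\<bar>) \<le> real J * (40 * n)" by (simp add: mult_ac)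
  then have "(\<Sum>j\<in>{J<..<n}. \<bar>e j - l j\<bar>) \<le> 40 * n"
    using J by (simp add: mult_le_cancel_left_pos)
  then have dev: "\<bar>(\<Sum>j\<in>{J<..<n}. e j) - (\<Sum>j\<in>{J<..<n}. l j)\<bar> \<le> 40 * n"
    unfolding sum_subtractf[symmetric] by (rule order_trans[OF sum_abs])
  have head: "0 \<le> (\<Sum>j\<le>J. e j)" "(\<Sum>j\<le>J. e j) \<le> 8 * n"
  proof -
    show "0 \<le> (\<Sum>j\<le>J. e j)" using bounds \<open>J < n\<close> by (intro sum_nonneg) auto
    have "(\<Sum>j\<le>J. e j) \<le> (\<Sum>j\<le>J. 4 * real J)"
    proof (rule sum_mono)
      fix j assume "j \<in> {..J}"
      then show "e j \<le> 4 * real J"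
        using bounds[of j] \<open>J < n\<close> J(1) by auto
    qed
    also have "\<dots> = (real J + 1) * (4 * real J)" by simp
    also have "\<dots> \<le> (2 * real J) * (4 * real J)" using J by (intro mult_right_mono) auto
    also have "\<dots> \<le> 8 * n" using J2 by simp
    finally show "(\<Sum>j\<le>J. e j) \<le> 8 * n" .
  qed
  have "real n * (1 / real j) \<le> l j" if "J < j" "j < n" for j
  proof -
    have "\<epsilon> * j \<le> \<epsilon> * n" using that \<epsilon> by (intro mult_left_mono) auto
    then show ?thesis using that J \<epsilon> by (simp add: l_def N_def field_simps)
  qed
  then have l_lower: "real n * (\<Sum>j\<in>{J<..<n}. 1 / real j) \<le> (\<Sum>j\<in>{J<..<n}. l j)"
    unfolding sum_distrib_left by (intro sum_mono) auto
  \<comment> \<open>The excess of \<open>l j\<close> over \<open>n / j\<close> is at most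
    \<open>n / (j - 1) - n / j\<close>, which telescopes.\<close>
  have "1 * (\<Sum>j\<in>{J<..<n}. l j - real n * (1 / real j)) \<le> 1 * (real n / J)"
  proof (rule telescoping_sum_le)
    fix j assume j: "J < j" "j < n"
    have "l j \<le> (2 * real n) / (2 * (real j - 1))"
      unfolding l_def using j J N \<epsilon> by (intro frac_le) auto
    also have "\<dots> = real n / (real j - 1)"
      by (subst mult_divide_mult_cancel_left) auto
    finally show "1 * (l j - real n * (1 / real j)) \<le> 1 * (real n / real (j - 1) - real n / real j)"
      using j J by (simp add: of_nat_diff)
  qed (use \<open>J < n\<close> in auto)
  also have "real n / J \<le> n"
    using J \<open>2 \<le> n\<close> by (simp add: divide_le_eq)
  finally have l_upper: "(\<Sum>j\<in>{J<..<n}. l j) \<le> real n * (\<Sum>j\<in>{J<..<n}. 1 / real j) + n"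
    by (simp add: sum_subtractf sum_distrib_left)
  \<comment> \<open>Replacing \<open>J\<close> by \<open>sqrt n\<close> in the logarithms costs at
    most \<open>ln 2\<close>, by \<open>J + 1 \<le> 2 * sqrt n\<close> and
    \<open>sqrt n \<le> 2 * J\<close>.\<close>
  have ln_sqrt: "ln (sqrt n) = ln n / 2" using \<open>2 \<le> n\<close> by (simp add: ln_sqrt)
  have ln2: "ln 2 \<le> (1::real)" using ln_le_minus_one[of "2::real"] by simp
  have "ln (real J + 1) \<le> ln (2 * sqrt n)"
    using J \<open>2 \<le> n\<close> by (subst ln_le_cancel_iff) auto
  also have "\<dots> \<le> 1 + ln n / 2"
    using \<open>2 \<le> n\<close> ln_sqrt ln2 by (subst ln_mult) auto
  finally have lnJ1: "ln (real J + 1) \<le> 1 + ln n / 2" .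
  have "ln (sqrt n) \<le> ln (2 * real J)"
    using J \<open>2 \<le> n\<close> by (subst ln_le_cancel_iff) auto
  also have "\<dots> \<le> 1 + ln J"
    using J ln2 by (subst ln_mult) auto
  finally have lnJ: "ln n / 2 \<le> 1 + ln J" unfolding ln_sqrt .
  have "ln (real n - 1) \<le> ln n" using \<open>2 \<le> n\<close> by simp
  then have "\<bar>(\<Sum>j\<in>{J<..<n}. 1 / real j) - ln n / 2\<bar> \<le> 1"
    using harmonic_sum_bounds[of J n] J(1) \<open>J < n\<close> lnJ lnJ1 by linarith
  then have "real n * \<bar>(\<Sum>j\<in>{J<..<n}. 1 / real j) - ln n / 2\<bar> \<le> real n * 1"
    by (intro mult_left_mono) auto
  moreover have "real n * (\<Sum>j\<in>{J<..<n}. 1 / real j) - real n / 2 * ln n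
      = real n * ((\<Sum>j\<in>{J<..<n}. 1 / real j) - ln n / 2)"
    by (simp only: right_diff_distrib times_divide_eq_right times_divide_eq_left)
  ultimately have harm: "\<bar>real n * (\<Sum>j\<in>{J<..<n}. 1 / real j) - real n / 2 * ln n\<bar> \<le> n"
    by (simp only: abs_mult abs_of_nat mult_1_right)
  have "{..<n} = {..J} \<union> {J<..<n}" using \<open>J < n\<close> by auto
  then have "(\<Sum>j<n. e j) = (\<Sum>j\<le>J. e j) + (\<Sum>j\<in>{J<..<n}. e j)"
    by (simp add: sum.union_disjoint ivl_disj_int)
  \<comment> \<open>The constant is \<open>50 = 8 + 40 + 1 + 1\<close>: the head, the distance to
    \<open>l\<close>, the passage from \<open>l j\<close> to \<open>n / j\<close>, and the harmonic
    sum.\<close>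
  then show ?thesis
    using head dev l_lower l_upper harm by linarith
qed

section \<open>The urn without removals\<close>

text \<open>
  Adding the values at mirror states makes the walk start at a reflecting barrier, which determines the
  first difference.
\<close>

lemma balanced_walk:
  fixes E :: "urn \<Rightarrow> real"
  assumes E: "\<And>w b. \<not> absorbed (w, b) \<Longrightarrow> E (w, b) = c + real w / real (w + b) * E (w + 1, b - 1)
                + real b / real (w + b) * E (w - 1, b + 1)"
    and "1 \<le> k"
  defines "s \<equiv> (\<lambda>j. E (k + j, k - j) + E (k - j, k + j))"
  shows "s 0 - s 1 = 2 * c"
    and "\<And>j. 1 \<le> j \<Longrightarrow> j < k \<Longrightarrow>
      (real k + real j) * (s j - s (Suc j)) = 4 * real k * c + (real k - real j) * (s (j - 1) - s j)"
proof -
  \<comment> \<open>At \<open>j = 0\<close> both summands of \<open>s\<close> are the value at the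
    balanced urn, whose neighbours are mirror images with equal weights.\<close>
  have "E (k, k) = c + real k / real (k + k) * E (k + 1, k - 1) + real k / real (k + k) * E (k - 1, k + 1)"
    using \<open>1 \<le> k\<close> by (intro E) (auto simp: absorbed_def)
  then show "s 0 - s 1 = 2 * c"
    using \<open>1 \<le> k\<close> by (simp add: s_def field_simps)
next
  fix j assume j: "1 \<le> j" "j < k"
  have mult: "2 * real k * (c + u / (2 * real k) * x + v / (2 * real k) * y) = 2 * real k * c + u * x + v * y"
    for u v x y :: real
    using j by (simp add: field_simps)
  have "E (k + j, k - j) = c + real (k + j) / (2 * real k) * E (k + j + 1, k - j - 1)
      + real (k - j) / (2 * real k) * E (k + j - 1, k - j + 1)"
    using E[of "k + j" "k - j"] j by (simp add: absorbed_def)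
  then have 1: "2 * real k * E (k + j, k - j) = 2 * real k * c + real (k + j) * E (k + j + 1, k - j - 1)
      + real (k - j) * E (k + j - 1, k - j + 1)"
    using mult by metis
  have "E (k - j, k + j) = c + real (k - j) / (2 * real k) * E (k - j + 1, k + j - 1)
      + real (k + j) / (2 * real k) * E (k - j - 1, k + j + 1)"
    using E[of "k - j" "k + j"] j by (simp add: absorbed_def)
  then have 2: "2 * real k * E (k - j, k + j) = 2 * real k * c + real (k - j) * E (k - j + 1, k + j - 1)
      + real (k + j) * E (k - j - 1, k + j + 1)"
    using mult by metis
  have s0: "s j = E (k + j, k - j) + E (k - j, k + j)"
    by (simp add: s_def)
  have s1: "s (Suc j) = E (k + j + 1, k - j - 1) + E (k - j - 1, k + j + 1)"
    by (simp add: s_def)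
  have "k + (j - 1) = k + j - 1" "k - (j - 1) = k - j + 1"
    using j by auto
  then have s2: "s (j - 1) = E (k + j - 1, k - j + 1) + E (k - j + 1, k + j - 1)"
    by (simp add: s_def)
  have "2 * real k * s j = 4 * real k * c + (real k + real j) * s (Suc j) + (real k - real j) * s (j - 1)"
    unfolding s0 s1 s2 using 1 2 j by (simp add: of_nat_diff algebra_simps)
  then show "(real k + real j) * (s j - s (Suc j)) = 4 * real k * c + (real k - real j) * (s (j - 1) - s j)"
    by (simp add: algebra_simps)
qed

text \<open>With \<open>c = 0\<close> the first difference vanishes and the recursion carries this
  to all others. So \<open>s\<close> is constant up to the absorbed urns \<open>(2 * k, 0)\<close>
  and \<open>(0, 2 * k)\<close>, whose values add up to \<open>2 * k\<close>.\<close>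

lemma V_diag:
  assumes "1 \<le> k"
  shows "V k k = k"
proof -
  define s where "s = (\<lambda>j. expected_black id (k + j, k - j) + expected_black id (k - j, k + j))"
  have walk: "s 0 - s 1 = 0"
    "\<And>j. 1 \<le> j \<Longrightarrow> j < k \<Longrightarrow> (real k + real j) * (s j - s (Suc j)) = (real k - real j) * (s (j - 1) - s j)"
    using balanced_walk[of "expected_black id" 0, OF _ assms] expected_black_step[of id]
    by (simp_all add: s_def)
  have diff: "s j - s (Suc j) = 0" if "j < k" for j
    using that
  proof (induction j)
    case 0
    then show ?case using walk(1) by simp
  next
    case (Suc j)
    with walk(2)[of "Suc j"] have "(real k + real (Suc j)) * (s (Suc j) - s (Suc (Suc j))) = 0"
      by simp
    then show ?case
      unfolding mult_eq_0_iff by linarith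
  qed
  have "s 0 - s k = (\<Sum>j<k. s j - s (Suc j))"
    by (simp add: sum_lessThan_telescope')
  also have "\<dots> = 0" using diff by simp
  finally have "s 0 = s k" by simp
  moreover have "s k = 2 * k"
    by (simp add: s_def expected_black_absorbed absorbed_def)
  ultimately show ?thesis by (simp add: s_def V_def)
qed

lemma T_diag_growth:
  assumes "2 \<le> k"
  shows "\<bar>T k k - real k / 2 * ln k\<bar> \<le> 50 * real k"
proof -
  define s where "s = (\<lambda>j. expected_time id (k + j, k - j) + expected_time id (k - j, k + j))"
  have walk: "s 0 - s 1 = 2"
    "\<And>j. 1 \<le> j \<Longrightarrow> j < k \<Longrightarrow>
      (real k + real j) * (s j - s (Suc j)) = 4 * real k + (real k - real j) * (s (j - 1) - s j)"
    using balanced_walk[of "expected_time id" 1 k] expected_time_step[of id] assms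
    by (simp_all add: s_def)
  \<comment> \<open>Halving undoes the addition of mirror states and gives the recursion its source
    term \<open>2 * k\<close>.\<close>
  have "\<bar>(\<Sum>j<k. (s j - s (Suc j)) / 2) - real k / 2 * ln k\<bar> \<le> 50 * real k"
  proof (rule log_growth[where \<epsilon> = 0])
    fix j assume j: "1 \<le> j" "j < k"
    then show "(real k + real j - 0) * ((s j - s (Suc j)) / 2)
        = (2 * real k - 0) + (real k - real j) * ((s (j - 1) - s (Suc (j - 1))) / 2)"
      using walk(2)[of j] by simp
  qed (use walk(1) assms in auto)
  also have "(\<Sum>j<k. (s j - s (Suc j)) / 2) = (s 0 - s k) / 2"
    by (simp add: sum_lessThan_telescope' flip: sum_divide_distrib)
  also have "s k = 0"
    by (simp add: s_def expected_time_absorbed absorbed_def)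
  also have "(s 0 - 0) / 2 = T k k"
    by (simp add: s_def T_def)
  finally show ?thesis .
qed

section \<open>The urn under Policy A\<close>

text \<open>
  Let \<open>m - i\<close> white and \<open>m - 1 + i\<close> black balls be state \<open>i\<close>. Then \<open>excursion m c a i\<close> is the difference
  of a function with expected decrease \<open>c\<close> per draw between states \<open>i\<close> and \<open>i + 1\<close>, \<open>a\<close> being its value
  at \<open>i = 0\<close>, where Policy A removes two white balls.
\<close>

primrec excursion :: "nat \<Rightarrow> real \<Rightarrow> real \<Rightarrow> nat \<Rightarrow> real" where
  "excursion m c a 0 = a"
| "excursion m c a (Suc i) =
     ((2 * real m - 1) * c + (real m - real (Suc i)) * excursion m c a i) / (real m - 1 + real (Suc i))"

lemma excursion_rec:
  assumes "1 \<le> m" "1 \<le> i"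
  shows "(real m - 1 + real i) * excursion m c a i
       = (2 * real m - 1) * c + (real m - real i) * excursion m c a (i - 1)"
  using assms by (cases i) (simp_all add: add_pos_nonneg)

text \<open>The recursion is linear in the source \<open>c\<close> and the initial value
  \<open>a\<close>. The split isolates the first difference, which is unknown at first and has to be
  solved for.\<close>

lemma excursion_affine: "excursion m c a i = c * excursion m 1 0 i + a * excursion m 0 1 i"
proof (induction i)
  case 0
  then show ?case by simp
next
  case (Suc i)
  define x y u v q where "x = excursion m 1 0 i" and "y = excursion m 0 1 i"
    and "u = 2 * real m - 1" and "v = real m - real (Suc i)" and "q = real m - 1 + real (Suc i)"
  have "(u * c + v * (c * x + a * y)) / q = c * ((u * 1 + v * x) / q) + a * ((u * 0 + v * y) / q)"
    by (simp add: algebra_simps flip: add_divide_distrib)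
  then show ?case
    unfolding excursion.simps Suc x_def y_def u_def v_def q_def .
qed

text \<open>
  The probability that, started with \<open>m - 1\<close> white and \<open>m\<close> black balls, all balls become black before
  Policy A removes anything.
\<close>

definition absorption_weight :: "nat \<Rightarrow> real" where
  "absorption_weight m = 1 / (\<Sum>i<m. excursion m 0 1 i)"

lemma absorption_weight_bounds:
  assumes "2 \<le> m"
  shows "0 < absorption_weight m" "1 / (4 * sqrt m) \<le> absorption_weight m" "absorption_weight m \<le> 1"
proof -
  have B: "1 \<le> (\<Sum>i<m. excursion m 0 1 i)" "(\<Sum>i<m. excursion m 0 1 i) \<le> 4 * sqrt m"
    using excursion_rec[of m _ 0 1] assms by (auto intro!: excursion_sum_bounds)
  then show "0 < absorption_weight m" "1 / (4 * sqrt m) \<le> absorption_weight m" "absorption_weight m \<le> 1"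
    unfolding absorption_weight_def using assms by (auto intro!: divide_left_mono)
qed

text \<open>State \<open>0\<close> is reduced by the policy to the start of level
  \<open>m - 1\<close>, state \<open>1\<close> is the start of level \<open>m\<close>, and state
  \<open>m\<close> is absorbed. The first difference enters the telescoped sum linearly; solving for
  it gives the weighted average.\<close>

lemma policy_A_walk:
  fixes E :: "urn \<Rightarrow> real"
  assumes E: "\<And>w b. w < b \<Longrightarrow> \<not> absorbed (w, b) \<Longrightarrow> E (w, b) = c + real w / real (w + b) * E (w + 1, b - 1)
                + real b / real (w + b) * E (w - 1, b + 1)"
    and idem: "\<And>s. E (policy_A s) = E s"
    and "2 \<le> m"
  shows "E (m - 1, m) =
    absorption_weight m * (E (0, 2 * m - 1) + c * (\<Sum>i<m. excursion m 1 0 i))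
    + (1 - absorption_weight m) * E (m - 2, m - 1)"
proof -
  let ?p = "absorption_weight m" and ?B = "\<Sum>i<m. excursion m 0 1 i"
  define y where "y i = E (m - i, m - 1 + i)" for i
  have "policy_A (m, m - 1) = (m - 2, m - 1)"
    using \<open>2 \<le> m\<close> policy_A_ge[of "m - 1" m] by (simp add: numeral_2_eq_2)
  then have y0: "y 0 = E (m - 2, m - 1)"
    using idem[of "(m, m - 1)"] by (simp add: y_def)
  have y1: "y 1 = E (m - 1, m)" and ym: "y m = E (0, 2 * m - 1)"
    using \<open>2 \<le> m\<close> by (simp_all add: y_def mult_2)
  \<comment> \<open>In these states white balls are in the minority, so Policy A does nothing and
    the plain first-step equation holds.\<close>
  have y: "(real m - 1 + real i) * (y i - y (Suc i)) = (2 * real m - 1) * c + (real m - real i) * (y (i - 1) - y i)"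
    if i: "1 \<le> i" "i < m" for i
  proof -
    have idx: "m - i + 1 = m - (i - 1)" "m - 1 + i - 1 = m - 1 + (i - 1)"
      "m - i - 1 = m - Suc i" "m - 1 + i + 1 = m - 1 + Suc i" "m - i + (m - 1 + i) = 2 * m - 1"
      using i by auto
    have "y i = c + real (m - i) / real (2 * m - 1) * y (i - 1) + real (m - 1 + i) / real (2 * m - 1) * y (Suc i)"
      using E[of "m - i" "m - 1 + i"] i unfolding y_def idx by (simp add: absorbed_def)
    moreover define N where "N = real (2 * m - 1)"
    ultimately have "y i = c + real (m - i) / N * y (i - 1) + real (m - 1 + i) / N * y (Suc i)"
      by simp
    then have "N * y i = N * c + real (m - i) * y (i - 1) + real (m - 1 + i) * y (Suc i)"
      using i by (simp add: N_def distrib_left)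
    moreover have "N = 2 * real m - 1" "real (m - i) = real m - real i" "real (m - 1 + i) = real m - 1 + real i"
      using i by (simp_all add: N_def of_nat_diff)
    ultimately show ?thesis
      by (simp add: algebra_simps)
  qed
  have a: "y i - y (Suc i) = excursion m c (y 0 - y 1) i" if "i < m" for i
    using that
  proof (induction i)
    case 0
    then show ?case by simp
  next
    case (Suc i)
    then have "(real m - 1 + real (Suc i)) * (y (Suc i) - y (Suc (Suc i)))
        = (real m - 1 + real (Suc i)) * excursion m c (y 0 - y 1) (Suc i)"
      using y[of "Suc i"] excursion_rec[of m "Suc i"] by (simp del: excursion.simps of_nat_Suc)
    then show ?case
      using Suc.prems unfolding mult_cancel_left by auto
  qed
  have "y 0 - y m = (\<Sum>i<m. y i - y (Suc i))"
    by (simp add: sum_lessThan_telescope')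
  also have "\<dots> = (\<Sum>i<m. c * excursion m 1 0 i + (y 0 - y 1) * excursion m 0 1 i)"
    by (intro sum.cong refl) (simp only: a excursion_affine[of m c "y 0 - y 1"] lessThan_iff)
  also have "\<dots> = c * (\<Sum>i<m. excursion m 1 0 i) + (y 0 - y 1) * ?B"
    by (simp add: sum.distrib sum_distrib_left)
  finally have "?p * (y 0 - y m) = ?p * (c * (\<Sum>i<m. excursion m 1 0 i)) + (y 0 - y 1) * (?p * ?B)"
    by (simp only: distrib_left mult_ac)
  moreover have "?p * ?B = 1"
    using absorption_weight_bounds(1)[OF \<open>2 \<le> m\<close>] by (simp add: absorption_weight_def)
  ultimately have "y 1 = ?p * (y m + c * (\<Sum>i<m. excursion m 1 0 i)) + (1 - ?p) * y 0"
    by (simp add: algebra_simps)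
  then show ?thesis
    unfolding y0 y1 ym .
qed

lemma V_A_diag_growth:
  assumes "1 \<le> k"
  shows "\<bar>V_A k k - 2 * real k\<bar> \<le> 1 + 4 * sqrt k * 2"
proof -
  define S where "S m = expected_black policy_A (m - 1, m)" for m
  have E: "expected_black policy_A (w, b) = real w / real (w + b) * expected_black policy_A (w + 1, b - 1)
      + real b / real (w + b) * expected_black policy_A (w - 1, b + 1)"
    if "w < b" "\<not> absorbed (w, b)" for w b
    using that by (intro expected_black_step) (simp_all add: policy_A_less)
  have "\<bar>S k - 2 * real k\<bar> \<le> 1 + 4 * sqrt k * 2"
  \<comment> \<open>\<open>c\<close> is the gap between \<open>2 * m - 1\<close> and
    \<open>2 * m\<close>, and \<open>d\<close> is the increment of \<open>2 * m\<close>.\<close>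
  proof (rule weighted_average_deviation[where p = absorption_weight and A = "\<lambda>m. 2 * real m - 1" and S = S
        and L = "\<lambda>m. 2 * real m" and c = "\<lambda>_. 1" and d = "\<lambda>_. 2"])
    fix m :: nat assume m: "2 \<le> m"
    show "1 / (4 * sqrt m) \<le> absorption_weight m" "absorption_weight m \<le> 1"
      using absorption_weight_bounds[OF m] by simp_all
    have "expected_black policy_A (0, 2 * m - 1) = 2 * real m - 1"
      using m by (subst expected_black_absorbed) (auto simp: policy_A_less absorbed_def of_nat_diff)
    then show "S m = absorption_weight m * (2 * real m - 1) + (1 - absorption_weight m) * S (m - 1)"
      using policy_A_walk[of "expected_black policy_A" 0 m] E expected_idem(1)[OF policy_A_idem] m
      by (simp add: S_def numeral_2_eq_2)
  next
    show "\<bar>S 1 - 2 * real 1\<bar> \<le> 1"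
      by (simp add: S_def expected_black_absorbed policy_A_less absorbed_def)
  qed (use assms in \<open>auto simp: of_nat_diff\<close>)
  also have "S k = V_A k k"
    using expected_idem(1)[OF policy_A_idem, of "(k, k)"] assms
    by (simp add: S_def V_A_def policy_A_ge)
  finally show ?thesis .
qed

lemma T_A_diag_growth:
  assumes "1 \<le> k"
  shows "\<bar>T_A k k - real k / 2 * ln k\<bar> \<le> 50 * real k + 4 * sqrt k * (ln k + 1)"
proof -
  define S where "S m = expected_time policy_A (m - 1, m)" for m
  have E: "expected_time policy_A (w, b) = 1 + real w / real (w + b) * expected_time policy_A (w + 1, b - 1)
      + real b / real (w + b) * expected_time policy_A (w - 1, b + 1)"
    if "w < b" "\<not> absorbed (w, b)" for w b
    using that by (intro expected_time_step) (simp_all add: policy_A_less)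
  have "\<bar>S k - real k / 2 * ln k\<bar> \<le> 50 * real k + 4 * sqrt k * (ln k + 1)"
  \<comment> \<open>\<open>A m\<close> is the time until absorption or first removal, divided by the
    absorption probability; \<open>c\<close> is the error in \<open>log_growth\<close>, and
    \<open>d\<close> bounds the increment of \<open>L\<close>.\<close>
  proof (rule weighted_average_deviation[where p = absorption_weight and A = "\<lambda>m. \<Sum>i<m. excursion m 1 0 i" and S = S
        and L = "\<lambda>m. real m / 2 * ln m" and c = "\<lambda>m. 50 * real m" and d = "\<lambda>m. ln m + 1"])
    fix m :: nat assume m: "2 \<le> m"
    show "1 / (4 * sqrt m) \<le> absorption_weight m" "absorption_weight m \<le> 1"
      using absorption_weight_bounds[OF m] by simp_all
    have "expected_time policy_A (0, 2 * m - 1) = 0"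
      using m by (subst expected_time_absorbed) (auto simp: policy_A_less absorbed_def)
    then show "S m = absorption_weight m * (\<Sum>i<m. excursion m 1 0 i) + (1 - absorption_weight m) * S (m - 1)"
      using policy_A_walk[of "expected_time policy_A" 1 m] E expected_idem(2)[OF policy_A_idem] m
      by (simp add: S_def numeral_2_eq_2)
    show "\<bar>(\<Sum>i<m. excursion m 1 0 i) - real m / 2 * ln m\<bar> \<le> 50 * real m"
    proof (rule log_growth[where \<epsilon> = 1])
      fix i assume "1 \<le> i" "i < m"
      then show "(real m + real i - 1) * excursion m 1 0 i
          = (2 * real m - 1) + (real m - real i) * excursion m 1 0 (i - 1)"
        using excursion_rec[of m i 1 0] m by (simp add: algebra_simps)
    qed (use m in auto)
    \<comment> \<open>The increment of \<open>L\<close> is \<open>(ln m + D) / 2\<close>, and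
      \<open>D\<close> stays bounded because
      \<open>ln m - ln (m - 1) \<le> 1 / (m - 1)\<close>.\<close>
    define D where "D = (real m - 1) * (ln m - ln (real m - 1))"
    have "D \<le> 1"
      using ln_diff_bounds(2)[of "m - 1"] m by (simp add: D_def of_nat_diff field_simps)
    moreover have "0 \<le> D" "0 \<le> ln m"
      using m by (simp_all add: D_def)
    moreover have "real m / 2 * ln m - real (m - 1) / 2 * ln (real (m - 1)) = (ln m + D) / 2"
      using m by (simp add: D_def of_nat_diff field_simps)
    ultimately show "\<bar>real m / 2 * ln m - real (m - 1) / 2 * ln (real (m - 1))\<bar> \<le> ln m + 1"
      by simp
  next
    show "\<bar>S 1 - real 1 / 2 * ln (real 1)\<bar> \<le> 50 * real 1"
      by (simp add: S_def expected_time_absorbed policy_A_less absorbed_def)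
  qed (use assms in auto)
  also have "S k = T_A k k"
    using expected_idem(2)[OF policy_A_idem, of "(k, k)"] assms
    by (simp add: S_def T_A_def policy_A_ge)
  finally show ?thesis .
qed

section \<open>Asymptotic ratios\<close>

lemma tendsto_ratio_1:
  fixes f L u :: "nat \<Rightarrow> real"
  assumes "eventually (\<lambda>k. \<bar>f k - L k\<bar> \<le> u k) sequentially" "eventually (\<lambda>k. 0 < L k) sequentially"
    and "(\<lambda>k. u k / L k) \<longlonglongrightarrow> 0"
  shows "(\<lambda>k. f k / L k) \<longlonglongrightarrow> 1"
proof (rule LIM_zero_cancel, rule Lim_null_comparison[OF _ assms(3)])
  show "eventually (\<lambda>k. norm (f k / L k - 1) \<le> u k / L k) sequentially"
    using assms(1,2)
  proof eventually_elim
    case (elim k)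
    then have "f k / L k - 1 = (f k - L k) / L k" by (simp add: diff_divide_distrib)
    with elim show ?case by (simp add: divide_right_mono)
  qed
qed

theorem corollary2p2:
  shows "((\<lambda>k. V_A k k / (2 * V k k)) \<longlonglongrightarrow> 1) \<and> ((\<lambda>k. T_A k k / T k k) \<longlonglongrightarrow> 1)"
proof
  have "(\<lambda>k. V_A k k / (2 * real k)) \<longlonglongrightarrow> 1"
  proof (rule tendsto_ratio_1)
    show "eventually (\<lambda>k. \<bar>V_A k k - 2 * real k\<bar> \<le> 1 + 4 * sqrt k * 2) sequentially"
      using eventually_ge_at_top[of 1] by eventually_elim (rule V_A_diag_growth)
    show "(\<lambda>k. (1 + 4 * sqrt (real k) * 2) / (2 * real k)) \<longlonglongrightarrow> 0"
      by real_asymp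
  qed real_asymp
  moreover have "eventually (\<lambda>k. V_A k k / (2 * real k) = V_A k k / (2 * V k k)) sequentially"
    using eventually_ge_at_top[of 1] by eventually_elim (simp add: V_diag)
  ultimately show "(\<lambda>k. V_A k k / (2 * V k k)) \<longlonglongrightarrow> 1"
    by (rule Lim_transform_eventually)
  let ?L = "\<lambda>k. real k / 2 * ln (real k)"
  have L: "eventually (\<lambda>k. 0 < ?L k) sequentially"
    by real_asymp
  have "(\<lambda>k. T_A k k / ?L k) \<longlonglongrightarrow> 1"
  proof (rule tendsto_ratio_1[OF _ L])
    show "eventually (\<lambda>k. \<bar>T_A k k - ?L k\<bar> \<le> 50 * real k + 4 * sqrt k * (ln k + 1)) sequentially"
      using eventually_ge_at_top[of 1] by eventually_elim (rule T_A_diag_growth)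
    show "(\<lambda>k. (50 * real k + 4 * sqrt (real k) * (ln (real k) + 1)) / ?L k) \<longlonglongrightarrow> 0"
      by real_asymp
  qed
  moreover have "(\<lambda>k. T k k / ?L k) \<longlonglongrightarrow> 1"
  proof (rule tendsto_ratio_1[OF _ L])
    show "eventually (\<lambda>k. \<bar>T k k - ?L k\<bar> \<le> 50 * real k) sequentially"
      using eventually_ge_at_top[of 2] by eventually_elim (rule T_diag_growth)
    show "(\<lambda>k. (50 * real k) / ?L k) \<longlonglongrightarrow> 0"
      by real_asymp
  qed
  \<comment> \<open>Both times have the same leading term \<open>?L\<close>, which is eventually
    positive and cancels.\<close>
  ultimately have "(\<lambda>k. (T_A k k / ?L k) / (T k k / ?L k)) \<longlonglongrightarrow> 1 / 1"
    by (intro tendsto_divide) auto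
  moreover have "eventually (\<lambda>k. (T_A k k / ?L k) / (T k k / ?L k) = T_A k k / T k k) sequentially"
    using L by eventually_elim auto
  ultimately show "(\<lambda>k. T_A k k / T k k) \<longlonglongrightarrow> 1"
    by (simp add: Lim_transform_eventually)
qed

end
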